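(* Let $(M,g)$ be an $n$-dimensional $(N(k),\xi)$-semi-Riemannian manifold, let $a_0,\dots,a_7$ be real numbers, and suppose $M$ is $(R,\mathcal{T}_a,S)$-pseudosymmetric, i.e. $R\cdot\mathcal{T}_a=L_S\,Q(S,\mathcal{T}_a)$ holds on $\mathcal{U}_S=\{x\in M:Q(S,\mathcal{T}_a)\neq 0\text{ at }x\}$ for some smooth function $L_S$ on $\mathcal{U}_S$. Then (on $\mathcal{U}_S$), for all vector fields $X,V,W$: \begin{align*} &k(a_1+a_3+a_5)\big(S(X,V)-k(n-1)g(X,V)\big)\eta(W)+k(a_1+a_2+a_6)\big(S(X,W)-k(n-1)g(X,W)\big)\eta(V)\\ =\;&L_S\Big(-(ka_0+k(n-1)(a_4+a_5+a_6)+a_7r)S(X,V)\eta(W)\\ &+k(n-1)(ka_0+k(n-1)(a_4+a_6)+a_7r)g(X,V)\eta(W)\\ &+k^2(n-1)^2(a_4+a_5)g(X,W)\eta(V)-k(n-1)(a_4+a_5+a_6)S(X,W)\eta(V)\\ &+a_5S^2(X,V)\eta(W)+a_6S^2(X,W)\eta(V)\Big). \end{align*}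
   Context: $(M,g)$ is an $n$-dimensional semi-Riemannian manifold; $R$ is its curvature tensor (sign convention: constant curvature $c$ means $R(X,Y)Z=c(g(Y,Z)X-g(X,Z)Y)$), $S(Y,Z)=\mathrm{tr}(X\mapsto R(X,Y)Z)$ the Ricci tensor, $Q$ the Ricci operator ($g(QX,Y)=S(X,Y)$), $r$ the scalar curvature, $S^2(X,Y)=S(QX,Y)$. $(N(k),\xi)$-semi-Riemannian manifold: $k$ is a real number and $\xi$ is a vector field with $g(\xi,\xi)=\varepsilon\in\{1,-1\}$ lying in the $k$-nullity distribution, i.e. $R(X,Y)\xi=k(g(Y,\xi)X-g(X,\xi)Y)$ for all $X,Y$; $\eta(X)=\varepsilon g(X,\xi)$. For real $a_0,\dots,a_7$, $\mathcal{T}_a(X,Y)Z=a_0R(X,Y)Z+a_1S(Y,Z)X+a_2S(X,Z)Y+a_3S(X,Y)Z+a_4g(Y,Z)QX+a_5g(X,Z)QY+a_6g(X,Y)QZ+a_7r(g(Y,Z)X-g(X,Z)Y)$. For the $(1,3)$ tensor $\mathcal{T}_a$ and an endomorphism $F$: $(F\cdot\mathcal{T}_a)(U,V)W=F(\mathcal{T}_a(U,V)W)-\mathcal{T}_a(FU,V)W-\mathcal{T}_a(U,FV)W-\mathcal{T}_a(U,V)FW$. $R\cdot\mathcal{T}_a$ is the tensor $(U,V,W;Z,X)\mapsto(R(Z,X)\cdot\mathcal{T}_a)(U,V)W$, and $Q(S,\mathcal{T}_a)(U,V,W;Z,X)=((Z\wedge_S X)\cdot\mathcal{T}_a)(U,V)W$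 with $(Z\wedge_S X)Y=S(X,Y)Z-S(Z,Y)X$. *)

theory Defs
  imports "HOL-Analysis.Analysis"
begin

section \<open>Smooth maps\<close>

primrec Ck_on :: "nat \<Rightarrow> ('a::real_normed_vector \<Rightarrow> 'b::real_normed_vector) \<Rightarrow> 'a set \<Rightarrow> bool" where
  "Ck_on 0 = (\<lambda>f S. continuous_on S f)"
| "Ck_on (Suc k) = (\<lambda>f S. (\<forall>x\<in>S. f differentiable at x) \<and>
     (\<forall>v. Ck_on k (\<lambda>x. frechet_derivative f (at x) v) S))"

text \<open>Intended for open \<open>S\<close>, since the derivatives are taken in a full neighbourhood.\<close>

definition smooth_on :: "'a set \<Rightarrow> ('a::real_normed_vector \<Rightarrow> 'b::real_normed_vector) \<Rightarrow> bool" where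
  "smooth_on S f \<longleftrightarrow> (\<forall>k. Ck_on k f S)"


section \<open>Smooth manifolds and tensor fields\<close>

text \<open>
  A chart is a pair of a domain and a coordinate map. The dimension of the manifold is
  \<open>CARD('n)\<close>. Geometric objects are represented by their components with respect to each chart
  of a smooth atlas; a tangent vector at \<open>p\<close> is, in a chart around \<open>p\<close>, an element of
  \<open>real^'n\<close>. An equation between tensors at \<open>p\<close> is required in every chart of the atlas
  whose domain contains \<open>p\<close>.
\<close>

type_synonym ('a, 'n) chart = "'a set \<times> ('a \<Rightarrow> real^'n)"

definition in_chart :: "('a, 'n::finite) chart \<Rightarrow> ('a \<Rightarrow> 'b) \<Rightarrow> real^'n \<Rightarrow> 'b" where
  "in_chart c f = f \<circ> inv_into (fst c) (snd c)"

definition jacobian :: "('a, 'n::finite) chart \<Rightarrow> ('a, 'n) chart \<Rightarrow> 'a \<Rightarrow> real^'n^'n" where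
  "jacobian c d p = matrix (frechet_derivative (in_chart c (snd d)) (at (snd c p)))"

locale smooth_manifold =
  fixes M :: "'a topology" and A :: "('a, 'n::finite) chart set"
  assumes Hausdorff: "Hausdorff_space M"
    and second_countable: "second_countable M"
    and charts_cover: "topspace M = \<Union> (fst ` A)"
    and chart_openin: "c \<in> A \<Longrightarrow> openin M (fst c)"
    and chart_open_image: "c \<in> A \<Longrightarrow> open (snd c ` fst c)"
    and chart_homeomorphic:
      "c \<in> A \<Longrightarrow> homeomorphic_map (subtopology M (fst c)) (top_of_set (snd c ` fst c)) (snd c)"
    and charts_compatible:
      "c \<in> A \<Longrightarrow> d \<in> A \<Longrightarrow> smooth_on (snd c ` (fst c \<inter> fst d)) (in_chart c (snd d))"

text \<open>Smooth real functions and smooth vector fields on an open subset \<open>U\<close>.\<close>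

definition smooth_function :: "('a, 'n::finite) chart set \<Rightarrow> 'a set \<Rightarrow> ('a \<Rightarrow> real) \<Rightarrow> bool" where
  "smooth_function A U f \<longleftrightarrow> (\<forall>c\<in>A. smooth_on (snd c ` (fst c \<inter> U)) (in_chart c f))"

definition vector_field ::
  "('a, 'n::finite) chart set \<Rightarrow> 'a set \<Rightarrow> (('a, 'n) chart \<Rightarrow> 'a \<Rightarrow> real^'n) \<Rightarrow> bool" where
  "vector_field A U X \<longleftrightarrow>
     (\<forall>c\<in>A. smooth_on (snd c ` (fst c \<inter> U)) (in_chart c (X c))) \<and>
     (\<forall>c\<in>A. \<forall>d\<in>A. \<forall>p\<in>fst c \<inter> fst d \<inter> U. X d p = jacobian c d p *v X c p)"


section \<open>Semi-Riemannian metrics\<close>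

text \<open>A metric is given by its Gram matrices with respect to the coordinate frames.\<close>

type_synonym ('a, 'n) metric_field = "('a, 'n) chart \<Rightarrow> 'a \<Rightarrow> real^'n^'n"

text \<open>The largest dimension of a subspace on which the form is negative definite.\<close>

definition metric_index :: "real^'n^'n \<Rightarrow> nat" where
  "metric_index G = Max {dim V |V. subspace V \<and> (\<forall>v\<in>V. v \<noteq> 0 \<longrightarrow> v \<bullet> (G *v v) < 0)}"

locale semi_riemannian_manifold = smooth_manifold M A
  for M :: "'a topology" and A :: "('a, 'n::finite) chart set" +
  fixes g :: "('a, 'n) metric_field"
  assumes metric_smooth: "c \<in> A \<Longrightarrow> smooth_on (snd c ` fst c) (in_chart c (g c))"
    and metric_transform: "c \<in> A \<Longrightarrow> d \<in> A \<Longrightarrow> p \<in> fst c \<inter> fst d \<Longrightarrow>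
      g c p = transpose (jacobian c d p) ** g d p ** jacobian c d p"
    and metric_symmetric: "c \<in> A \<Longrightarrow> p \<in> fst c \<Longrightarrow> transpose (g c p) = g c p"
    and metric_nondegenerate: "c \<in> A \<Longrightarrow> p \<in> fst c \<Longrightarrow> invertible (g c p)"
    and metric_constant_index: "\<exists>\<nu>. \<forall>c\<in>A. \<forall>p\<in>fst c. metric_index (g c p) = \<nu>"

definition metric_at :: "('a, 'n::finite) metric_field \<Rightarrow> ('a, 'n) chart \<Rightarrow> 'a \<Rightarrow> real^'n \<Rightarrow> real^'n \<Rightarrow> real" where
  "metric_at g c p u v = u \<bullet> (g c p *v v)"


section \<open>Levi-Civita connection and curvature\<close>

text \<open>Coordinate expressions in a chart; \<open>\<gamma>\<close> is the Gram matrix of the metric as a function of the coordinates.\<close>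

definition partial_deriv :: "'n \<Rightarrow> (real^'n::finite \<Rightarrow> real) \<Rightarrow> real^'n \<Rightarrow> real" where
  "partial_deriv i f x = frechet_derivative f (at x) (axis i 1)"

definition christoffel :: "(real^'n::finite \<Rightarrow> real^'n^'n) \<Rightarrow> real^'n \<Rightarrow> 'n \<Rightarrow> 'n \<Rightarrow> 'n \<Rightarrow> real" where
  "christoffel \<gamma> x m i j = (1/2) * (\<Sum>l\<in>UNIV. matrix_inv (\<gamma> x) $ m $ l *
     (partial_deriv i (\<lambda>y. \<gamma> y $ j $ l) x + partial_deriv j (\<lambda>y. \<gamma> y $ i $ l) x
      - partial_deriv l (\<lambda>y. \<gamma> y $ i $ j) x))"

definition levi_civita ::
  "(real^'n::finite \<Rightarrow> real^'n^'n) \<Rightarrow> (real^'n \<Rightarrow> real^'n) \<Rightarrow> (real^'n \<Rightarrow> real^'n) \<Rightarrow> real^'n \<Rightarrow> real^'n" where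
  "levi_civita \<gamma> X Y x = frechet_derivative Y (at x) (X x) +
     (\<chi> m. \<Sum>i\<in>UNIV. \<Sum>j\<in>UNIV. christoffel \<gamma> x m i j * X x $ i * Y x $ j)"

definition lie_bracket :: "(real^'n::finite \<Rightarrow> real^'n) \<Rightarrow> (real^'n \<Rightarrow> real^'n) \<Rightarrow> real^'n \<Rightarrow> real^'n" where
  "lie_bracket X Y x = frechet_derivative Y (at x) (X x) - frechet_derivative X (at x) (Y x)"

definition curvature_of_fields ::
  "(real^'n::finite \<Rightarrow> real^'n^'n) \<Rightarrow> (real^'n \<Rightarrow> real^'n) \<Rightarrow> (real^'n \<Rightarrow> real^'n) \<Rightarrow> (real^'n \<Rightarrow> real^'n)
    \<Rightarrow> real^'n \<Rightarrow> real^'n" where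
  "curvature_of_fields \<gamma> X Y Z x =
     levi_civita \<gamma> X (levi_civita \<gamma> Y Z) x - levi_civita \<gamma> Y (levi_civita \<gamma> X Z) x
     - levi_civita \<gamma> (lie_bracket X Y) Z x"

text \<open>
  The curvature tensor at \<open>p\<close>: by tensoriality its value on tangent vectors is that of the
  curvature on any local extensions; we extend with constant coordinate components.
  With this sign, constant curvature \<open>\<kappa>\<close> reads
  \<open>R(u,v)w = \<kappa> (g(v,w) u - g(u,w) v)\<close>.
\<close>

definition riemann ::
  "('a, 'n::finite) metric_field \<Rightarrow> ('a, 'n) chart \<Rightarrow> 'a \<Rightarrow> real^'n \<Rightarrow> real^'n \<Rightarrow> real^'n \<Rightarrow> real^'n" where
  "riemann g c p u v w =
     curvature_of_fields (in_chart c (g c)) (\<lambda>_. u) (\<lambda>_. v) (\<lambda>_. w) (snd c p)"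

definition ricci :: "('a, 'n::finite) metric_field \<Rightarrow> ('a, 'n) chart \<Rightarrow> 'a \<Rightarrow> real^'n \<Rightarrow> real^'n \<Rightarrow> real" where
  "ricci g c p y z = trace (matrix (\<lambda>x. riemann g c p x y z))"

definition ricci_operator :: "('a, 'n::finite) metric_field \<Rightarrow> ('a, 'n) chart \<Rightarrow> 'a \<Rightarrow> real^'n \<Rightarrow> real^'n" where
  "ricci_operator g c p x = (THE q. \<forall>y. metric_at g c p q y = ricci g c p x y)"

definition scalar_curvature :: "('a, 'n::finite) metric_field \<Rightarrow> ('a, 'n) chart \<Rightarrow> 'a \<Rightarrow> real" where
  "scalar_curvature g c p = trace (matrix (ricci_operator g c p))"

definition ricci_sq :: "('a, 'n::finite) metric_field \<Rightarrow> ('a, 'n) chart \<Rightarrow> 'a \<Rightarrow> real^'n \<Rightarrow> real^'n \<Rightarrow> real" where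
  "ricci_sq g c p x y = ricci g c p (ricci_operator g c p x) y"


section \<open>\<open>(N(k),\<xi>)\<close>-semi-Riemannian manifolds\<close>

definition in_nullity_distribution ::
  "('a, 'n::finite) metric_field \<Rightarrow> ('a, 'n) chart \<Rightarrow> 'a \<Rightarrow> real \<Rightarrow> real^'n \<Rightarrow> bool" where
  "in_nullity_distribution g c p k z \<longleftrightarrow>
     (\<forall>x y. riemann g c p x y z = k *\<^sub>R (metric_at g c p y z *\<^sub>R x - metric_at g c p x z *\<^sub>R y))"

locale Nk_semi_riemannian_manifold = semi_riemannian_manifold M A g
  for M :: "'a topology" and A :: "('a, 'n::finite) chart set" and g :: "('a, 'n) metric_field" +
  fixes k \<epsilon> :: real and \<xi> :: "('a, 'n) chart \<Rightarrow> 'a \<Rightarrow> real^'n"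
  assumes eps: "\<epsilon> \<in> {1, -1}"
    and xi_field: "vector_field A (topspace M) \<xi>"
    and xi_unit: "c \<in> A \<Longrightarrow> p \<in> fst c \<Longrightarrow> metric_at g c p (\<xi> c p) (\<xi> c p) = \<epsilon>"
    and xi_nullity: "c \<in> A \<Longrightarrow> p \<in> fst c \<Longrightarrow> in_nullity_distribution g c p k (\<xi> c p)"

definition eta ::
  "('a, 'n::finite) metric_field \<Rightarrow> real \<Rightarrow> (('a, 'n) chart \<Rightarrow> 'a \<Rightarrow> real^'n) \<Rightarrow> ('a, 'n) chart \<Rightarrow> 'a \<Rightarrow> real^'n \<Rightarrow> real" where
  "eta g \<epsilon> \<xi> c p x = \<epsilon> * metric_at g c p x (\<xi> c p)"


section \<open>The tensor \<open>T\<^sub>a\<close> and pseudosymmetry\<close>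

text \<open>Only the coefficients \<open>a 0, \<dots>, a 7\<close> occur.\<close>

definition T_tensor ::
  "(nat \<Rightarrow> real) \<Rightarrow> ('a, 'n::finite) metric_field \<Rightarrow> ('a, 'n) chart \<Rightarrow> 'a \<Rightarrow> real^'n \<Rightarrow> real^'n \<Rightarrow> real^'n \<Rightarrow> real^'n" where
  "T_tensor a g c p x y z =
     a 0 *\<^sub>R riemann g c p x y z
     + (a 1 * ricci g c p y z) *\<^sub>R x
     + (a 2 * ricci g c p x z) *\<^sub>R y
     + (a 3 * ricci g c p x y) *\<^sub>R z
     + (a 4 * metric_at g c p y z) *\<^sub>R ricci_operator g c p x
     + (a 5 * metric_at g c p x z) *\<^sub>R ricci_operator g c p y
     + (a 6 * metric_at g c p x y) *\<^sub>R ricci_operator g c p z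
     + (a 7 * scalar_curvature g c p) *\<^sub>R (metric_at g c p y z *\<^sub>R x - metric_at g c p x z *\<^sub>R y)"

definition endo_act :: "('v \<Rightarrow> 'v) \<Rightarrow> ('v \<Rightarrow> 'v \<Rightarrow> 'v \<Rightarrow> 'v) \<Rightarrow> 'v \<Rightarrow> 'v \<Rightarrow> 'v \<Rightarrow> 'v::real_vector" where
  "endo_act F T u v w = F (T u v w) - T (F u) v w - T u (F v) w - T u v (F w)"

definition wedge :: "('v \<Rightarrow> 'v \<Rightarrow> real) \<Rightarrow> 'v \<Rightarrow> 'v \<Rightarrow> 'v \<Rightarrow> 'v::real_vector" where
  "wedge B z x y = B x y *\<^sub>R z - B z y *\<^sub>R x"

text \<open>The tensors \<open>R \<cdot> T\<^sub>a\<close> and \<open>Q(S, T\<^sub>a)\<close>, with arguments in the order \<open>(u, v, w; z, x)\<close>.\<close>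

definition R_dot_T ::
  "(nat \<Rightarrow> real) \<Rightarrow> ('a, 'n::finite) metric_field \<Rightarrow> ('a, 'n) chart \<Rightarrow> 'a
    \<Rightarrow> real^'n \<Rightarrow> real^'n \<Rightarrow> real^'n \<Rightarrow> real^'n \<Rightarrow> real^'n \<Rightarrow> real^'n" where
  "R_dot_T a g c p u v w z x = endo_act (riemann g c p z x) (T_tensor a g c p) u v w"

definition Q_S_T ::
  "(nat \<Rightarrow> real) \<Rightarrow> ('a, 'n::finite) metric_field \<Rightarrow> ('a, 'n) chart \<Rightarrow> 'a
    \<Rightarrow> real^'n \<Rightarrow> real^'n \<Rightarrow> real^'n \<Rightarrow> real^'n \<Rightarrow> real^'n \<Rightarrow> real^'n" where
  "Q_S_T a g c p u v w z x = endo_act (wedge (ricci g c p) z x) (T_tensor a g c p) u v w"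

definition U_S :: "('a, 'n::finite) chart set \<Rightarrow> ('a, 'n) metric_field \<Rightarrow> (nat \<Rightarrow> real) \<Rightarrow> 'a set" where
  "U_S A g a = {p. \<exists>c\<in>A. p \<in> fst c \<and> (\<exists>u v w z x. Q_S_T a g c p u v w z x \<noteq> 0)}"

text \<open>\<open>(R, T\<^sub>a, S)\<close>-pseudosymmetry, with associated function \<open>L\<close>.\<close>

definition pseudosymmetric_with ::
  "('a, 'n::finite) chart set \<Rightarrow> ('a, 'n) metric_field \<Rightarrow> (nat \<Rightarrow> real) \<Rightarrow> ('a \<Rightarrow> real) \<Rightarrow> bool" where
  "pseudosymmetric_with A g a L \<longleftrightarrow>
     smooth_function A (U_S A g a) L \<and>
     (\<forall>p\<in>U_S A g a. \<forall>c\<in>A. p \<in> fst c \<longrightarrow>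
        (\<forall>u v w z x. R_dot_T a g c p u v w z x = L p *\<^sub>R Q_S_T a g c p u v w z x))"

end

theory Submission
  imports Defs
begin

text \<open>
  The identity is algebraic at each point: it is the \<open>\<xi>\<close>-component of the pseudosymmetry condition
  evaluated at \<open>(\<xi>, V, W; \<xi>, X)\<close>. Write \<open>e x = g(x, \<xi>)\<close>. The nullity condition and the pair symmetry of
  the curvature give \<open>R \<xi> x y = k (g(x,y) \<xi> - e y x)\<close>; the trace of the nullity condition gives
  \<open>S(y, \<xi>) = k (n - 1) e y\<close>, and since \<open>S\<close> is symmetric, \<open>\<xi>\<close> is an eigenvector of the Ricci operator. Hence \<open>R \<xi> X\<close> and \<open>\<xi> \<and>\<^sub>S X\<close> have the same shape, a
  wedge \<open>\<xi> \<and>\<^sub>B X\<close> for a bilinear form \<open>B\<close> whose contraction with \<open>\<xi>\<close> is a multiple of \<open>e\<close>, namely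
  \<open>B = k g\<close> and \<open>B = S\<close>. Lemma \<open>wedge_action\<close> computes the \<open>\<xi>\<close>-component of such a wedge acting on the
  tensor, and the two sides of the identity are its two instances.
  
  What this needs from geometry are the algebraic symmetries of the curvature of the Levi-Civita
  connection: antisymmetry in the first pair, skew symmetry with respect to the metric, the first
  Bianchi identity, and the symmetry of \<open>S\<close> that they imply. The curvature is given by derivatives
  of Christoffel symbols in a chart, so they are derived there. The Koszul formula shows that the
  connection is torsion free and metric (\<open>\<Gamma>_sym\<close>, \<open>metric_compatible\<close>). The first property gives the
  Bianchi identity (\<open>Rm_bianchi\<close>); differentiating the second once more, and using that second
  derivatives of the metric commute (\<open>second_derivative_symmetric\<close>), gives the skew symmetry
  (\<open>Rm_skew\<close>).
\<close>

section \<open>Symmetry of second derivatives\<close>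

text \<open>
  Apply the mean value theorem to the increment of \<open>f\<close> in direction \<open>v\<close>, moved along \<open>u\<close>: the
  second difference becomes \<open>t\<close> times an increment of the derivative along \<open>u\<close>. That increment is
  \<open>t * f'' v\<close> up to \<open>o(t)\<close>, because the derivative along \<open>u\<close> is itself differentiable at \<open>x\<close>.
\<close>

lemma second_difference_estimate:
  fixes f :: "'a::real_normed_vector \<Rightarrow> real"
  assumes "open U" "x \<in> U"
    and f': "\<And>y. y \<in> U \<Longrightarrow> (f has_derivative f' y) (at y)"
    and f'': "((\<lambda>y. f' y u) has_derivative f'') (at x)"
    and "e > 0"
  shows "\<exists>d>0. \<forall>t. 0 < t \<and> t < d \<longrightarrow>
    \<bar>f (x + t *\<^sub>R u + t *\<^sub>R v) - f (x + t *\<^sub>R u) - f (x + t *\<^sub>R v) + f x - t^2 * f'' v\<bar> \<le> e * t^2"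
proof -
  define N where "N = norm u + norm v + 1"
  have "N > 0" unfolding N_def by (smt (verit) norm_ge_zero)
  \<comment> \<open>Two first-order approximations are subtracted below, each at a distance at most \<open>t * N\<close> from
    \<open>x\<close>; their errors then add up to \<open>e * t\<close>.\<close>
  define e' where "e' = e / (2 * N)"
  have "e' > 0" using \<open>e > 0\<close> \<open>N > 0\<close> by (simp add: e'_def)
  interpret f'': bounded_linear f''
    using f'' by (rule has_derivative_bounded_linear)
  obtain d1 where "d1 > 0" and d1: "\<And>y. norm (y - x) < d1 \<Longrightarrow>
      \<bar>f' y u - f' x u - f'' (y - x)\<bar> \<le> e' * norm (y - x)"
    using f'' \<open>e' > 0\<close> unfolding has_derivative_at_alt real_norm_def by metis
  obtain d2 where "d2 > 0" and d2: "ball x d2 \<subseteq> U"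
    using \<open>open U\<close> \<open>x \<in> U\<close> open_contains_ball by blast
  define d where "d = min d1 d2 / N"
  have "d > 0" using \<open>d1 > 0\<close> \<open>d2 > 0\<close> \<open>N > 0\<close> by (simp add: d_def)
  have near: "norm (s *\<^sub>R u + r *\<^sub>R v) \<le> t * N"
    if "0 \<le> s" "s \<le> t" "0 \<le> r" "r \<le> t" for s r t
  proof -
    have "norm (s *\<^sub>R u + r *\<^sub>R v) \<le> s * norm u + r * norm v"
      using norm_triangle_ineq[of "s *\<^sub>R u" "r *\<^sub>R v"] that by simp
    also have "\<dots> \<le> t * norm u + t * norm v"
      using that by (intro add_mono mult_right_mono) auto
    also have "\<dots> \<le> t * N" using that unfolding N_def by (simp add: algebra_simps)
    finally show ?thesis .
  qed
  show ?thesis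
  proof (intro exI[of _ d] conjI allI impI)
    show "d > 0" by fact
    fix t :: real assume t: "0 < t \<and> t < d"
    then have tN: "t * N < d1" "t * N < d2"
      using \<open>N > 0\<close> by (auto simp: d_def field_simps)
    have inU: "x + (s *\<^sub>R u + r *\<^sub>R v) \<in> U" if "0 \<le> s" "s \<le> t" "0 \<le> r" "r \<le> t" for s r
    proof -
      have "dist x (x + (s *\<^sub>R u + r *\<^sub>R v)) = norm (s *\<^sub>R u + r *\<^sub>R v)"
        by (metis add_diff_cancel_left' dist_commute dist_norm)
      then show ?thesis using near[OF that] tN d2 by (auto simp: subset_iff)
    qed
    define \<phi> where "\<phi> s = f (x + (s *\<^sub>R u + t *\<^sub>R v)) - f (x + (s *\<^sub>R u + 0 *\<^sub>R v))" for s
    have deriv: "((\<lambda>s. f (x + (s *\<^sub>R u + r *\<^sub>R v))) has_derivative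
        (\<lambda>h. h * f' (x + (s *\<^sub>R u + r *\<^sub>R v)) u)) (at s)"
      if "0 \<le> s" "s \<le> t" "0 \<le> r" "r \<le> t" for s r
    proof -
      have D: "(f has_derivative f' (x + (s *\<^sub>R u + r *\<^sub>R v))) (at (x + (s *\<^sub>R u + r *\<^sub>R v)))"
        using f' inU that by blast
      then interpret b: bounded_linear "f' (x + (s *\<^sub>R u + r *\<^sub>R v))"
        by (rule has_derivative_bounded_linear)
      have "((\<lambda>s. x + (s *\<^sub>R u + r *\<^sub>R v)) has_derivative (\<lambda>h. h *\<^sub>R u)) (at s)"
        by (auto intro!: derivative_eq_intros)
      from has_derivative_compose[OF this D] show ?thesis
        by (simp add: b.scaleR)
    qed
    have \<phi>': "(\<phi> has_derivative (\<lambda>h. h * f' (x + (s *\<^sub>R u + t *\<^sub>R v)) u - h * f' (x + (s *\<^sub>R u + 0 *\<^sub>R v)) u)) (at s)"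
      if "0 \<le> s" "s \<le> t" for s
      unfolding \<phi>_def using that t by (intro has_derivative_diff deriv) auto
    have "continuous_on {0..t} \<phi>"
      by (intro continuous_at_imp_continuous_on ballI has_derivative_continuous[OF \<phi>']) auto
    from mvt[OF _ this, of "\<lambda>s h. h * f' (x + (s *\<^sub>R u + t *\<^sub>R v)) u - h * f' (x + (s *\<^sub>R u + 0 *\<^sub>R v)) u"]
    obtain s where s: "0 < s" "s < t" and "\<phi> t - \<phi> 0 =
        (t - 0) * f' (x + (s *\<^sub>R u + t *\<^sub>R v)) u - (t - 0) * f' (x + (s *\<^sub>R u + 0 *\<^sub>R v)) u"
      using \<phi>' t by auto
    then have \<phi>t: "\<phi> t - \<phi> 0 = t * (f' (x + (s *\<^sub>R u + t *\<^sub>R v)) u - f' (x + (s *\<^sub>R u + 0 *\<^sub>R v)) u)"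
      by (simp add: algebra_simps)
    have approx: "\<bar>f' (x + (s *\<^sub>R u + r *\<^sub>R v)) u - f' x u - f'' (s *\<^sub>R u + r *\<^sub>R v)\<bar> \<le> e' * (t * N)"
      if "0 \<le> r" "r \<le> t" for r
    proof -
      have n: "norm (s *\<^sub>R u + r *\<^sub>R v) \<le> t * N" using near s that by simp
      then have "\<bar>f' (x + (s *\<^sub>R u + r *\<^sub>R v)) u - f' x u - f'' (s *\<^sub>R u + r *\<^sub>R v)\<bar>
          \<le> e' * norm (s *\<^sub>R u + r *\<^sub>R v)"
        using d1[of "x + (s *\<^sub>R u + r *\<^sub>R v)"] tN by simp
      also have "\<dots> \<le> e' * (t * N)" using n \<open>e' > 0\<close> by simp
      finally show ?thesis .
    qed
    have "\<bar>f' (x + (s *\<^sub>R u + t *\<^sub>R v)) u - f' (x + (s *\<^sub>R u + 0 *\<^sub>R v)) u - t * f'' v\<bar> \<le> 2 * (e' * (t * N))"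
      using approx[of t] approx[of 0] t by (simp add: f''.add f''.scaleR)
    also have "2 * (e' * (t * N)) = e * t" using \<open>N > 0\<close> by (simp add: e'_def)
    finally have "t * \<bar>f' (x + (s *\<^sub>R u + t *\<^sub>R v)) u - f' (x + (s *\<^sub>R u + 0 *\<^sub>R v)) u - t * f'' v\<bar> \<le> t * (e * t)"
      using t by (intro mult_left_mono) auto
    moreover have "t * \<bar>f' (x + (s *\<^sub>R u + t *\<^sub>R v)) u - f' (x + (s *\<^sub>R u + 0 *\<^sub>R v)) u - t * f'' v\<bar>
      = \<bar>\<phi> t - \<phi> 0 - t^2 * f'' v\<bar>"
    proof -
      have "\<phi> t - \<phi> 0 - t^2 * f'' v =
        t * (f' (x + (s *\<^sub>R u + t *\<^sub>R v)) u - f' (x + (s *\<^sub>R u + 0 *\<^sub>R v)) u - t * f'' v)"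
        unfolding \<phi>t by (simp add: algebra_simps power2_eq_square)
      then show ?thesis using t by (simp add: abs_mult)
    qed
    ultimately show "\<bar>f (x + t *\<^sub>R u + t *\<^sub>R v) - f (x + t *\<^sub>R u) - f (x + t *\<^sub>R v) + f x - t^2 * f'' v\<bar> \<le> e * t^2"
      unfolding \<phi>_def by (simp add: algebra_simps power2_eq_square)
  qed
qed

text \<open>
  Young's theorem. The second difference is unchanged when \<open>u\<close> and \<open>v\<close> are exchanged, and both
  mixed derivatives are its limit after division by \<open>t\<^sup>2\<close>.
\<close>

lemma second_derivative_symmetric:
  fixes f :: "'a::real_normed_vector \<Rightarrow> real"
  assumes U: "open U" "x \<in> U"
    and f': "\<And>y. y \<in> U \<Longrightarrow> (f has_derivative f' y) (at y)"
    and u: "((\<lambda>y. f' y u) has_derivative Du) (at x)"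
    and v: "((\<lambda>y. f' y v) has_derivative Dv) (at x)"
  shows "Du v = Dv u"
proof (rule ccontr)
  assume "Du v \<noteq> Dv u"
  define e where "e = \<bar>Du v - Dv u\<bar> / 3"
  have "e > 0" using \<open>Du v \<noteq> Dv u\<close> by (simp add: e_def)
  obtain d1 where d1: "d1 > 0" "\<And>t. 0 < t \<Longrightarrow> t < d1 \<Longrightarrow>
    \<bar>f (x + t *\<^sub>R u + t *\<^sub>R v) - f (x + t *\<^sub>R u) - f (x + t *\<^sub>R v) + f x - t^2 * Du v\<bar> \<le> e * t^2"
    using second_difference_estimate[OF U f' u \<open>e > 0\<close>, of v] by blast
  obtain d2 where d2: "d2 > 0" "\<And>t. 0 < t \<Longrightarrow> t < d2 \<Longrightarrow>
    \<bar>f (x + t *\<^sub>R v + t *\<^sub>R u) - f (x + t *\<^sub>R v) - f (x + t *\<^sub>R u) + f x - t^2 * Dv u\<bar> \<le> e * t^2"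
    using second_difference_estimate[OF U f' v \<open>e > 0\<close>, of u] by blast
  define t where "t = min d1 d2 / 2"
  have t: "0 < t" "t < d1" "t < d2" using d1(1) d2(1) by (auto simp: t_def)
  have swap: "x + t *\<^sub>R v + t *\<^sub>R u = x + t *\<^sub>R u + t *\<^sub>R v" by simp
  have "\<bar>t^2 * Du v - t^2 * Dv u\<bar> \<le> 2 * (e * t^2)"
    using d1(2)[OF t(1,2)] d2(2)[OF t(1,3), unfolded swap] by arith
  moreover have "t^2 * Du v - t^2 * Dv u = t^2 * (Du v - Dv u)" by (simp add: right_diff_distrib)
  ultimately have "t^2 * \<bar>Du v - Dv u\<bar> \<le> t^2 * (2 * e)"
    by (simp add: abs_mult mult_ac)
  then have "\<bar>Du v - Dv u\<bar> \<le> 2 * e"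
    using t(1) by simp
  then show False using \<open>e > 0\<close> by (simp add: e_def)
qed

section \<open>Differentiating the inverse of a matrix\<close>

lemma matrix_inv_right_left:
  fixes A :: "real^'n^'n"
  assumes "invertible A"
  shows "A ** matrix_inv A = mat 1" "matrix_inv A ** A = mat 1"
  using someI_ex[OF assms[unfolded invertible_def]] unfolding matrix_inv_def by auto

text \<open>
  Cramer's rule for the columns of the inverse. It makes the entries of the inverse rational
  functions of those of \<open>A\<close>, hence differentiable wherever \<open>A\<close> is.
\<close>

lemma matrix_inv_entry_cramer:
  fixes A :: "real^'n^'n"
  assumes "invertible A"
  shows "matrix_inv A $ m $ l =
    det (\<chi> i j. if j = m then axis l 1 $ i else A $ i $ j) / det A"
proof -
  have "A *v column l (matrix_inv A) = axis l 1"
    using matrix_inv_right_left(1)[OF assms]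
    by (metis matrix_vector_mult_basis matrix_vector_mul_assoc matrix_vector_mul_lid)
  then have "column l (matrix_inv A) =
      (\<chi> k. det (\<chi> i j. if j = k then axis l 1 $ i else A $ i $ j) / det A)"
    using cramer assms invertible_det_nz by blast
  then show ?thesis
    by (auto simp: column_def vec_eq_iff)
qed

lemma differentiable_vec_nth:
  fixes f :: "'a::real_normed_vector \<Rightarrow> ('b::euclidean_space)^'n"
  assumes "f differentiable (at x)"
  shows "(\<lambda>y. f y $ i) differentiable (at x)"
  using assms bounded_linear.has_derivative[OF bounded_linear_vec_nth]
  unfolding differentiable_def by blast

lemma differentiable_componentwise_cart:
  fixes f :: "'a::real_normed_vector \<Rightarrow> real^'n"
  assumes "\<And>i. (\<lambda>y. f y $ i) differentiable (at x)"
  shows "f differentiable (at x)"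
proof -
  have "(\<lambda>y. \<Sum>i\<in>UNIV. f y $ i *\<^sub>R (axis i 1 :: real^'n)) differentiable (at x)"
    using assms by (intro differentiable_sum ballI differentiable_scaleR) auto
  moreover have "(\<lambda>y. \<Sum>i\<in>UNIV. f y $ i *\<^sub>R (axis i 1 :: real^'n)) = f"
    by (simp add: basis_expansion flip: scalar_mult_eq_scaleR)
  ultimately show ?thesis by simp
qed

lemma differentiable_prod:
  fixes f :: "'i \<Rightarrow> 'a::real_normed_vector \<Rightarrow> real"
  assumes "\<And>i. i \<in> I \<Longrightarrow> f i differentiable (at x)"
  shows "(\<lambda>y. \<Prod>i\<in>I. f i y) differentiable (at x)"
  using assms by (induction I rule: infinite_finite_induct) auto

lemma differentiable_det:
  fixes A :: "'a::real_normed_vector \<Rightarrow> real^'n^'n"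
  assumes "\<And>i j. (\<lambda>y. A y $ i $ j) differentiable (at x)"
  shows "(\<lambda>y. det (A y)) differentiable (at x)"
  unfolding det_def
  by (intro differentiable_sum ballI differentiable_mult differentiable_prod assms) auto

lemma differentiable_matrix_inv_entry:
  fixes A :: "'a::real_normed_vector \<Rightarrow> real^'n^'n"
  assumes A: "A differentiable (at x)"
    and U: "open U" "x \<in> U" and inv: "\<And>y. y \<in> U \<Longrightarrow> invertible (A y)"
  shows "(\<lambda>y. matrix_inv (A y) $ m $ l) differentiable (at x)"
proof -
  have entry: "(\<lambda>y. A y $ i $ j) differentiable (at x)" for i j
    by (intro differentiable_vec_nth A)
  have "(\<lambda>y. det (\<chi> i j. if j = m then axis l 1 $ i else A y $ i $ j) / det (A y)) differentiable (at x)"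
  proof (rule differentiable_divide)
    show "(\<lambda>y. det (\<chi> i j. if j = m then axis l 1 $ i else A y $ i $ j)) differentiable (at x)"
    proof (rule differentiable_det)
      fix i j
      show "(\<lambda>y. (\<chi> i j. if j = m then axis l 1 $ i else A y $ i $ j) $ i $ j) differentiable (at x)"
        by (cases "j = m") (auto simp: entry)
    qed
    show "(\<lambda>y. det (A y)) differentiable (at x)" by (intro differentiable_det entry)
    show "det (A x) \<noteq> 0" using inv U(2) invertible_det_nz by blast
  qed
  then obtain D where "((\<lambda>y. det (\<chi> i j. if j = m then axis l 1 $ i else A y $ i $ j) / det (A y))
      has_derivative D) (at x)"
    unfolding differentiable_def by blast
  then have "((\<lambda>y. matrix_inv (A y) $ m $ l) has_derivative D) (at x)"
    by (rule has_derivative_transform_within_open[OF _ U]) (simp add: matrix_inv_entry_cramer inv)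
  then show ?thesis unfolding differentiable_def by blast
qed

lemma has_derivative_matrix_vector_mult:
  fixes A :: "'a::real_normed_vector \<Rightarrow> real^'n^'m"
  assumes "(A has_derivative A') (at x)" "(f has_derivative f') (at x)"
  shows "((\<lambda>y. A y *v f y) has_derivative (\<lambda>h. A x *v f' h + A' h *v f x)) (at x)"
proof -
  have "bounded_bilinear ((*v) :: real^'n^'m \<Rightarrow> real^'n \<Rightarrow> real^'m)"
    unfolding bilinear_conv_bounded_bilinear[symmetric] bilinear_def
    by (auto intro!: linearI simp: algebra_simps scaleR_matrix_vector_assoc matrix_vector_mult_add_rdistrib)
  from bounded_bilinear.FDERIV[OF this assms] show ?thesis .
qed

section \<open>The Levi-Civita connection in coordinates\<close>

lemma linear_axis_expansion:
  fixes f :: "real^'n \<Rightarrow> real"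
  assumes "linear f"
  shows "f u = (\<Sum>i\<in>UNIV. u $ i * f (axis i 1))"
proof -
  have "f u = f (\<Sum>i\<in>UNIV. u $ i *\<^sub>R axis i 1)"
    by (simp add: basis_expansion flip: scalar_mult_eq_scaleR)
  also have "\<dots> = (\<Sum>i\<in>UNIV. u $ i * f (axis i 1))"
    by (simp add: linear_sum[OF assms] linear_scale[OF assms])
  finally show ?thesis .
qed

lemma bilinear_axis_expansion:
  fixes b :: "real^'n \<Rightarrow> real^'m \<Rightarrow> real"
  assumes "bilinear b"
  shows "b u v = (\<Sum>i\<in>UNIV. \<Sum>j\<in>UNIV. b (axis i 1) (axis j 1) * u $ i * v $ j)"
proof -
  have "linear (\<lambda>u. b u v)" "\<And>u. linear (b u)"
    using assms by (auto simp: bilinear_def)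
  from linear_axis_expansion[OF this(1), of u] linear_axis_expansion[OF this(2), of _ v]
  show ?thesis
    by (simp add: sum_distrib_left mult_ac)
qed

text \<open>
  A metric in the domain of one chart. Two derivatives of the metric are what the curvature
  involves.
\<close>

locale local_metric =
  fixes U :: "(real^'n::finite) set" and \<gamma> :: "real^'n \<Rightarrow> real^'n^'n"
  assumes open_U: "open U"
    and C2: "Ck_on (Suc (Suc 0)) \<gamma> U"
    and sym: "x \<in> U \<Longrightarrow> transpose (\<gamma> x) = \<gamma> x"
    and invertible: "x \<in> U \<Longrightarrow> invertible (\<gamma> x)"
begin

text \<open>
  Everything below is phrased through multilinear expressions in constant vector fields \<open>u\<close>,
  \<open>v\<close>, \<open>w\<close>, so that index sums occur only in the comparison with the Christoffel symbols:
  \<open>dG x u v w\<close> is the derivative of \<open>G(v,w)\<close> in direction \<open>u\<close>, \<open>\<Gamma> x v w\<close> is the covariant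
  derivative of \<open>w\<close> along \<open>v\<close>, and \<open>d\<Gamma> x u v w\<close> is the derivative of the latter in direction \<open>u\<close>.
\<close>

definition G :: "real^'n \<Rightarrow> real^'n \<Rightarrow> real^'n \<Rightarrow> real" where
  "G x v w = v \<bullet> (\<gamma> x *v w)"

definition dG :: "real^'n \<Rightarrow> real^'n \<Rightarrow> real^'n \<Rightarrow> real^'n \<Rightarrow> real" where
  "dG x u v w = v \<bullet> (frechet_derivative \<gamma> (at x) u *v w)"

definition \<Gamma> :: "real^'n \<Rightarrow> real^'n \<Rightarrow> real^'n \<Rightarrow> real^'n" where
  "\<Gamma> x v w = (\<chi> m. \<Sum>i\<in>UNIV. \<Sum>j\<in>UNIV. christoffel \<gamma> x m i j * v $ i * w $ j)"

definition d\<Gamma> :: "real^'n \<Rightarrow> real^'n \<Rightarrow> real^'n \<Rightarrow> real^'n \<Rightarrow> real^'n" where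
  "d\<Gamma> x u v w = frechet_derivative (\<lambda>y. \<Gamma> y v w) (at x) u"

definition Rm :: "real^'n \<Rightarrow> real^'n \<Rightarrow> real^'n \<Rightarrow> real^'n \<Rightarrow> real^'n" where
  "Rm x u v w = curvature_of_fields \<gamma> (\<lambda>_. u) (\<lambda>_. v) (\<lambda>_. w) x"

lemma \<gamma>_differentiable: "x \<in> U \<Longrightarrow> \<gamma> differentiable (at x)"
  and d\<gamma>_differentiable: "x \<in> U \<Longrightarrow> (\<lambda>y. frechet_derivative \<gamma> (at y) u) differentiable (at x)"
  using C2 by auto

lemma \<gamma>_has_derivative: "x \<in> U \<Longrightarrow> (\<gamma> has_derivative frechet_derivative \<gamma> (at x)) (at x)"
  using \<gamma>_differentiable frechet_derivative_works by blast

lemma bilinear_G: "bilinear (G x)"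
  unfolding bilinear_def G_def
  by (auto intro!: linearI simp: algebra_simps inner_simps)

lemma G_sym: "x \<in> U \<Longrightarrow> G x v w = G x w v"
  unfolding G_def by (metis dot_lmul_matrix inner_commute sym transpose_matrix_vector)

lemma G_nondegenerate:
  assumes "x \<in> U" "\<And>w. G x w a = G x w b"
  shows "a = b"
proof -
  have "\<gamma> x *v a = \<gamma> x *v b" using assms(2) unfolding G_def by (meson vector_eq_ldot)
  then show ?thesis
    by (metis assms(1) local.invertible matrix_inv_right_left(2) matrix_vector_mul_assoc matrix_vector_mul_lid)
qed

lemma G_has_derivative:
  assumes "x \<in> U" "(f has_derivative f') (at x)" "(h has_derivative h') (at x)"
  shows "((\<lambda>y. G y (f y) (h y)) has_derivative
      (\<lambda>u. dG x u (f x) (h x) + G x (f' u) (h x) + G x (f x) (h' u))) (at x)"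
proof -
  from has_derivative_inner[OF assms(2) has_derivative_matrix_vector_mult[OF \<gamma>_has_derivative[OF assms(1)] assms(3)]]
  show ?thesis unfolding G_def dG_def
    by (rule has_derivative_eq_rhs) (auto simp: inner_simps fun_eq_iff)
qed

lemma G_has_derivative_const:
  "x \<in> U \<Longrightarrow> ((\<lambda>y. G y v w) has_derivative (\<lambda>u. dG x u v w)) (at x)"
  using G_has_derivative[OF _ has_derivative_const has_derivative_const, of x v w]
  by (simp add: bilinear_lzero[OF bilinear_G] bilinear_rzero[OF bilinear_G])

lemma bilinear_dG: "bilinear (dG x u)"
  unfolding bilinear_def dG_def
  by (auto intro!: linearI simp: algebra_simps inner_simps)

lemma linear_dG: "x \<in> U \<Longrightarrow> linear (\<lambda>u. dG x u v w)"
  using G_has_derivative_const has_derivative_linear by blast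

lemma dG_sym:
  assumes x: "x \<in> U"
  shows "dG x u v w = dG x u w v"
proof -
  have "((\<lambda>y. G y w v) has_derivative (\<lambda>u. dG x u v w)) (at x)"
    by (rule has_derivative_transform_within_open[OF G_has_derivative_const[OF x] open_U x]) (rule G_sym)
  from has_derivative_unique[OF this G_has_derivative_const[OF x]] show ?thesis by metis
qed

lemma partial_deriv_eq_dG:
  assumes "x \<in> U"
  shows "partial_deriv i (\<lambda>y. \<gamma> y $ j $ l) x = dG x (axis i 1) (axis j 1) (axis l 1)"
proof -
  have "(\<lambda>y. \<gamma> y $ j $ l) = (\<lambda>y. G y (axis j 1) (axis l 1))"
    by (simp add: G_def matrix_vector_mult_basis column_def inner_axis')
  then show ?thesis
    unfolding partial_deriv_def
    using frechet_derivative_at[OF G_has_derivative_const[OF assms], of "axis j 1" "axis l 1"] by metis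
qed

text \<open>
  The right-hand side of the Koszul formula for constant fields, whose brackets vanish.
\<close>

definition koszul :: "real^'n \<Rightarrow> real^'n \<Rightarrow> real^'n \<Rightarrow> real^'n \<Rightarrow> real" where
  "koszul x u v w = (dG x u v w + dG x v u w - dG x w u v) / 2"

lemma bilinear_koszul: "x \<in> U \<Longrightarrow> bilinear (\<lambda>u v. koszul x u v w)"
  and linear_koszul: "x \<in> U \<Longrightarrow> linear (koszul x u v)"
  unfolding bilinear_def koszul_def
  by (auto intro!: linearI simp: linear_add[OF linear_dG] linear_scale[OF linear_dG]
      bilinear_ladd[OF bilinear_dG] bilinear_radd[OF bilinear_dG]
      bilinear_lmul[OF bilinear_dG] bilinear_rmul[OF bilinear_dG] field_simps)

text \<open>
  The index form of \<open>\<Gamma>\<close> is the Koszul form contracted with the inverse metric. This is the only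
  place where the Christoffel symbols are unfolded.
\<close>

lemma \<Gamma>_component:
  assumes x: "x \<in> U"
  shows "\<Gamma> x u v $ m = (\<Sum>l\<in>UNIV. matrix_inv (\<gamma> x) $ m $ l * koszul x u v (axis l 1))"
proof -
  have "\<Gamma> x u v $ m = (\<Sum>i\<in>UNIV. \<Sum>j\<in>UNIV. \<Sum>l\<in>UNIV. matrix_inv (\<gamma> x) $ m $ l *
      (koszul x (axis i 1) (axis j 1) (axis l 1) * u $ i * v $ j))"
    by (simp add: \<Gamma>_def christoffel_def partial_deriv_eq_dG[OF x] koszul_def sum_distrib_left
        sum_distrib_right mult_ac)
  also have "\<dots> = (\<Sum>l\<in>UNIV. \<Sum>i\<in>UNIV. \<Sum>j\<in>UNIV. matrix_inv (\<gamma> x) $ m $ l *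
      (koszul x (axis i 1) (axis j 1) (axis l 1) * u $ i * v $ j))"
    by (subst sum.swap, subst (2) sum.swap) (rule refl)
  also have "\<dots> = (\<Sum>l\<in>UNIV. matrix_inv (\<gamma> x) $ m $ l * koszul x u v (axis l 1))"
    by (subst (2) bilinear_axis_expansion[OF bilinear_koszul[OF x]]) (simp add: sum_distrib_left)
  finally show ?thesis .
qed

lemma G_\<Gamma>:
  assumes x: "x \<in> U"
  shows "G x w (\<Gamma> x u v) = koszul x u v w"
proof -
  let ?K = "\<chi> l. koszul x u v (axis l 1)"
  have "\<Gamma> x u v = matrix_inv (\<gamma> x) *v ?K"
    by (simp add: vec_eq_iff \<Gamma>_component[OF x] matrix_vector_mult_def)
  then have "\<gamma> x *v \<Gamma> x u v = ?K"
    using matrix_inv_right_left(1)[OF invertible[OF x]] by (simp add: matrix_vector_mul_assoc)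
  then have "G x w (\<Gamma> x u v) = (\<Sum>l\<in>UNIV. w $ l * koszul x u v (axis l 1))"
    by (simp add: G_def inner_vec_def)
  also have "\<dots> = koszul x u v w"
    by (rule linear_axis_expansion[OF linear_koszul[OF x], symmetric])
  finally show ?thesis .
qed

lemma bilinear_\<Gamma>: "bilinear (\<Gamma> x)"
  unfolding bilinear_def \<Gamma>_def
  by (auto intro!: linearI
      simp: vec_eq_iff distrib_left distrib_right sum.distrib sum_distrib_left mult_ac)

text \<open>
  The connection is torsion free, since the Koszul form is symmetric in \<open>u\<close> and \<open>v\<close>.
\<close>

lemma \<Gamma>_sym: "x \<in> U \<Longrightarrow> \<Gamma> x u v = \<Gamma> x v u"
  by (rule G_nondegenerate) (auto simp: G_\<Gamma> koszul_def dG_sym)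

text \<open>
  In the sum of the Koszul forms for \<open>(u,v,w)\<close> and \<open>(u,w,v)\<close> all terms but \<open>dG x u v w\<close> cancel.
\<close>

lemma metric_compatible:
  assumes x: "x \<in> U"
  shows "dG x u v w = G x (\<Gamma> x u v) w + G x v (\<Gamma> x u w)"
  using x by (simp add: G_sym[of x "\<Gamma> x u v" w] G_\<Gamma> koszul_def dG_sym[OF x, of _ v w]
     dG_sym[OF x, of v u w] dG_sym[OF x, of w u v] field_simps)

text \<open>
  Near \<open>x\<close>, \<open>\<Gamma>\<close> is a polynomial in the entries of the inverse metric and the first derivatives of
  the metric.
\<close>

lemma \<Gamma>_differentiable:
  assumes x: "x \<in> U"
  shows "(\<lambda>y. \<Gamma> y u v) differentiable (at x)"
proof (rule differentiable_componentwise_cart)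
  fix m
  have dG: "(\<lambda>y. dG y u v w) differentiable (at x)" for u v w
  proof -
    obtain D where "((\<lambda>y. frechet_derivative \<gamma> (at y) u) has_derivative D) (at x)"
      using d\<gamma>_differentiable[OF x] unfolding differentiable_def by blast
    from has_derivative_inner[OF has_derivative_const has_derivative_matrix_vector_mult[OF this has_derivative_const]]
    show ?thesis unfolding dG_def differentiable_def by blast
  qed
  have "(\<lambda>y. \<Sum>l\<in>UNIV. matrix_inv (\<gamma> y) $ m $ l * koszul y u v (axis l 1)) differentiable (at x)"
    unfolding koszul_def
    by (intro differentiable_sum ballI differentiable_mult differentiable_divide differentiable_add
        differentiable_diff dG differentiable_const
        differentiable_matrix_inv_entry[OF \<gamma>_differentiable[OF x] open_U x invertible]) auto
  then obtain D where "((\<lambda>y. \<Sum>l\<in>UNIV. matrix_inv (\<gamma> y) $ m $ l * koszul y u v (axis l 1))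
      has_derivative D) (at x)"
    unfolding differentiable_def by blast
  then have "((\<lambda>y. \<Gamma> y u v $ m) has_derivative D) (at x)"
    by (rule has_derivative_transform_within_open[OF _ open_U x]) (simp add: \<Gamma>_component)
  then show "(\<lambda>y. \<Gamma> y u v $ m) differentiable (at x)"
    unfolding differentiable_def by blast
qed

lemma \<Gamma>_has_derivative: "x \<in> U \<Longrightarrow> ((\<lambda>y. \<Gamma> y v w) has_derivative (\<lambda>u. d\<Gamma> x u v w)) (at x)"
  using \<Gamma>_differentiable frechet_derivative_works unfolding d\<Gamma>_def by blast

lemma linear_d\<Gamma>: "x \<in> U \<Longrightarrow> linear (\<lambda>u. d\<Gamma> x u v w)"
  using \<Gamma>_has_derivative has_derivative_linear by blast

lemma bilinear_d\<Gamma>: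
  assumes x: "x \<in> U"
  shows "bilinear (d\<Gamma> x u)"
proof -
  note D = has_derivative_unique[OF \<Gamma>_has_derivative[OF x]]
  have "d\<Gamma> x u (v + v') w = d\<Gamma> x u v w + d\<Gamma> x u v' w" for v v' w
    using D[of "v + v'" w, unfolded bilinear_ladd[OF bilinear_\<Gamma>],
        OF has_derivative_add[OF \<Gamma>_has_derivative[OF x] \<Gamma>_has_derivative[OF x]]] by metis
  moreover have "d\<Gamma> x u w (v + v') = d\<Gamma> x u w v + d\<Gamma> x u w v'" for v v' w
    using D[of w "v + v'", unfolded bilinear_radd[OF bilinear_\<Gamma>],
        OF has_derivative_add[OF \<Gamma>_has_derivative[OF x] \<Gamma>_has_derivative[OF x]]] by metis
  moreover have "d\<Gamma> x u (c *\<^sub>R v) w = c *\<^sub>R d\<Gamma> x u v w" for v w c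
    using D[of "c *\<^sub>R v" w, unfolded bilinear_lmul[OF bilinear_\<Gamma>],
        OF has_derivative_scaleR_right[OF \<Gamma>_has_derivative[OF x]]] by metis
  moreover have "d\<Gamma> x u w (c *\<^sub>R v) = c *\<^sub>R d\<Gamma> x u w v" for v w c
    using D[of w "c *\<^sub>R v", unfolded bilinear_rmul[OF bilinear_\<Gamma>],
        OF has_derivative_scaleR_right[OF \<Gamma>_has_derivative[OF x]]] by metis
  ultimately show ?thesis unfolding bilinear_def by (auto intro!: linearI)
qed

lemma d\<Gamma>_sym:
  assumes x: "x \<in> U"
  shows "d\<Gamma> x u v w = d\<Gamma> x u w v"
proof -
  have "((\<lambda>y. \<Gamma> y w v) has_derivative (\<lambda>u. d\<Gamma> x u v w)) (at x)"
    by (rule has_derivative_transform_within_open[OF \<Gamma>_has_derivative[OF x] open_U x]) (rule \<Gamma>_sym)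
  from has_derivative_unique[OF this \<Gamma>_has_derivative[OF x]] show ?thesis by metis
qed

section \<open>Symmetries of the curvature in coordinates\<close>

lemma Rm_eq:
  "Rm x u v w = d\<Gamma> x u v w - d\<Gamma> x v u w + \<Gamma> x u (\<Gamma> x v w) - \<Gamma> x v (\<Gamma> x u w)"
proof -
  have 1: "levi_civita \<gamma> (\<lambda>_. v) (\<lambda>_. w) = (\<lambda>y. \<Gamma> y v w)" for v w
    by (simp add: fun_eq_iff levi_civita_def \<Gamma>_def)
  have 2: "levi_civita \<gamma> (\<lambda>_. u) (\<lambda>y. \<Gamma> y v w) x = d\<Gamma> x u v w + \<Gamma> x u (\<Gamma> x v w)" for u v w
    by (simp add: levi_civita_def \<Gamma>_def d\<Gamma>_def)
  have 3: "lie_bracket (\<lambda>_. u) (\<lambda>_. v) = (\<lambda>_. 0)"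
    by (simp add: fun_eq_iff lie_bracket_def)
  have "Rm x u v w = d\<Gamma> x u v w + \<Gamma> x u (\<Gamma> x v w) - (d\<Gamma> x v u w + \<Gamma> x v (\<Gamma> x u w)) - \<Gamma> x 0 w"
    unfolding Rm_def curvature_of_fields_def 3 1 2 ..
  then show ?thesis
    by (simp add: bilinear_lzero[OF bilinear_\<Gamma>])
qed

lemma linear_Rm:
  assumes x: "x \<in> U"
  shows "linear (\<lambda>u. Rm x u v w)" "linear (\<lambda>v. Rm x u v w)" "linear (\<lambda>w. Rm x u v w)"
  unfolding Rm_eq
  by (auto intro!: linearI simp: linear_add[OF linear_d\<Gamma>[OF x]] linear_scale[OF linear_d\<Gamma>[OF x]]
      bilinear_ladd[OF bilinear_d\<Gamma>[OF x]] bilinear_radd[OF bilinear_d\<Gamma>[OF x]]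
      bilinear_lmul[OF bilinear_d\<Gamma>[OF x]] bilinear_rmul[OF bilinear_d\<Gamma>[OF x]]
      bilinear_ladd[OF bilinear_\<Gamma>] bilinear_radd[OF bilinear_\<Gamma>]
      bilinear_lmul[OF bilinear_\<Gamma>] bilinear_rmul[OF bilinear_\<Gamma>] algebra_simps)

lemma Rm_antisym: "Rm x u v w = - Rm x v u w"
  by (simp add: Rm_eq)

text \<open>
  The first Bianchi identity: by symmetry of \<open>\<Gamma>\<close> and of \<open>d\<Gamma>\<close> the twelve terms cancel in pairs.
\<close>

lemma Rm_bianchi:
  assumes x: "x \<in> U"
  shows "Rm x u v w + Rm x v w u + Rm x w u v = 0"
  by (simp add: Rm_eq d\<Gamma>_sym[OF x, of _ v u] d\<Gamma>_sym[OF x, of _ w v] d\<Gamma>_sym[OF x, of _ w u]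
      \<Gamma>_sym[OF x, of v u] \<Gamma>_sym[OF x, of w v] \<Gamma>_sym[OF x, of w u])

text \<open>
  The second derivative of the metric, obtained by differentiating metric compatibility instead of
  the definition of \<open>dG\<close>; in this form it contains the terms \<open>d\<Gamma>\<close> of the curvature.
\<close>

lemma dG_has_derivative:
  assumes x: "x \<in> U"
  shows "((\<lambda>y. dG y u v w) has_derivative
    (\<lambda>z. dG x z (\<Gamma> x u v) w + G x (d\<Gamma> x z u v) w + (dG x z v (\<Gamma> x u w) + G x v (d\<Gamma> x z u w)))) (at x)"
proof (rule has_derivative_transform_within_open[OF _ open_U x])
  show "((\<lambda>y. G y (\<Gamma> y u v) w + G y v (\<Gamma> y u w)) has_derivative
    (\<lambda>z. dG x z (\<Gamma> x u v) w + G x (d\<Gamma> x z u v) w + (dG x z v (\<Gamma> x u w) + G x v (d\<Gamma> x z u w)))) (at x)"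
    using has_derivative_add[OF G_has_derivative[OF x \<Gamma>_has_derivative[OF x] has_derivative_const]
      G_has_derivative[OF x has_derivative_const \<Gamma>_has_derivative[OF x]]]
    by (simp add: bilinear_lzero[OF bilinear_G] bilinear_rzero[OF bilinear_G])
qed (simp add: metric_compatible)

text \<open>
  Second derivatives of \<open>G(v,w)\<close> along \<open>z\<close> and \<open>u\<close> commute. Inserting the formula for them and
  eliminating \<open>dG\<close> by metric compatibility, the terms \<open>G (\<Gamma> x u v) (\<Gamma> x z w)\<close> and
  \<open>G (\<Gamma> x z v) (\<Gamma> x u w)\<close> occur on both sides, and what is left is skew symmetry of the curvature.
\<close>

lemma Rm_skew:
  assumes x: "x \<in> U"
  shows "G x (Rm x u z v) w = - G x (Rm x u z w) v"
proof -
  have "dG x z (\<Gamma> x u v) w + G x (d\<Gamma> x z u v) w + (dG x z v (\<Gamma> x u w) + G x v (d\<Gamma> x z u w))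
      = dG x u (\<Gamma> x z v) w + G x (d\<Gamma> x u z v) w + (dG x u v (\<Gamma> x z w) + G x v (d\<Gamma> x u z w))"
    using second_derivative_symmetric[OF open_U x G_has_derivative_const dG_has_derivative[OF x] dG_has_derivative[OF x]] .
  then show ?thesis
    unfolding G_sym[OF x, of _ v] metric_compatible[OF x] Rm_eq
    by (simp add: bilinear_ladd[OF bilinear_G] bilinear_lsub[OF bilinear_G] G_sym[OF x, of v]
        G_sym[OF x, of "\<Gamma> x u v"] G_sym[OF x, of "\<Gamma> x u w"])
qed

end

section \<open>The curvature and Ricci tensors at a point\<close>

text \<open>
  The usual octahedron argument: combine the four Bianchi identities obtained by cyclically
  rotating \<open>x\<close>, \<open>y\<close>, \<open>z\<close>, \<open>w\<close>.
\<close>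

lemma curvature_pair_symmetry:
  fixes \<rho> :: "'v \<Rightarrow> 'v \<Rightarrow> 'v \<Rightarrow> 'v \<Rightarrow> real"
  assumes a12: "\<And>x y z w. \<rho> x y z w = - \<rho> y x z w"
    and a34: "\<And>x y z w. \<rho> x y z w = - \<rho> x y w z"
    and bianchi: "\<And>x y z w. \<rho> x y z w + \<rho> y z x w + \<rho> z x y w = 0"
  shows "\<rho> x y z w = \<rho> z w x y"
  using bianchi[of x y z w] bianchi[of y z w x] bianchi[of z w x y] bianchi[of w x y z]
    a12[of z x y w] a12[of w y z x] a12[of x z w y] a12[of y w x z]
    a34[of x y z w] a34[of y z x w] a34[of z w x y] a34[of w x y z] a34[of x z y w] a34[of y w z x]
  by (smt (verit) a12 a34)

locale semi_riemannian_point = semi_riemannian_manifold M A g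
  for M :: "'a topology" and A :: "('a, 'n::finite) chart set" and g :: "('a, 'n) metric_field" +
  fixes c :: "('a, 'n) chart" and p :: 'a
  assumes c: "c \<in> A" and p: "p \<in> fst c"
begin

lemma in_chart_snd: "q \<in> fst c \<Longrightarrow> in_chart c f (snd c q) = f q"
proof -
  have "inj_on (snd c) (topspace (subtopology M (fst c)))"
    using homeomorphic_imp_injective_map chart_homeomorphic[OF c] by blast
  then have "inj_on (snd c) (fst c)"
    using openin_subset[OF chart_openin[OF c]] by (simp add: Int_absorb1)
  then show "q \<in> fst c \<Longrightarrow> in_chart c f (snd c q) = f q"
    by (simp add: in_chart_def)
qed

text \<open>
  The value at \<open>p\<close> of the curvature is that of the metric in coordinates, so the symmetries
  carry over.
\<close>

sublocale coords: local_metric "snd c ` fst c" "in_chart c (g c)"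
proof
  show "open (snd c ` fst c)" using chart_open_image[OF c] .
  show "Ck_on (Suc (Suc 0)) (in_chart c (g c)) (snd c ` fst c)"
    using metric_smooth[OF c] unfolding smooth_on_def by blast
qed (auto simp: in_chart_snd metric_symmetric[OF c] metric_nondegenerate[OF c])

abbreviation "G \<equiv> metric_at g c p"
abbreviation "R \<equiv> riemann g c p"
abbreviation "S \<equiv> ricci g c p"
abbreviation "Q \<equiv> ricci_operator g c p"
abbreviation "r \<equiv> scalar_curvature g c p"

lemma chart_image: "snd c p \<in> snd c ` fst c"
  using p by blast

lemma G_coords: "G = coords.G (snd c p)"
  by (simp add: fun_eq_iff metric_at_def coords.G_def in_chart_snd p)

lemma R_coords: "R = coords.Rm (snd c p)"
  by (simp add: fun_eq_iff riemann_def coords.Rm_def)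

lemma bilinear_G: "bilinear G"
  unfolding G_coords by (rule coords.bilinear_G)

lemmas G_simps = bilinear_ladd[OF bilinear_G] bilinear_radd[OF bilinear_G]
  bilinear_lsub[OF bilinear_G] bilinear_rsub[OF bilinear_G]
  bilinear_lmul[OF bilinear_G] bilinear_rmul[OF bilinear_G]

lemma G_sym: "G x y = G y x"
  unfolding G_coords by (rule coords.G_sym[OF chart_image])

lemma G_nondegenerate: "(\<And>w. G a w = G b w) \<Longrightarrow> a = b"
  using coords.G_nondegenerate[OF chart_image] unfolding G_coords[symmetric] by (metis G_sym)

lemma R_linear: "linear (\<lambda>y. R x y z)" "linear (R x y)"
  unfolding R_coords using coords.linear_Rm[OF chart_image] by auto

lemma R_antisym: "R x y z = - R y x z"
  unfolding R_coords by (rule coords.Rm_antisym)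

lemma R_skew: "G (R x y z) w = - G (R x y w) z"
  unfolding R_coords G_coords by (rule coords.Rm_skew[OF chart_image])

lemma R_pair_sym: "G (R x y z) w = G (R z w x) y"
proof (rule curvature_pair_symmetry[of "\<lambda>x y z w. G (R x y z) w"])
  show "G (R x y z) w = - G (R y x z) w" for x y z w
    by (subst R_antisym) (rule bilinear_lneg[OF bilinear_G])
  show "G (R x y z) w + G (R y z x) w + G (R z x y) w = 0" for x y z w
    using coords.Rm_bianchi[OF chart_image] bilinear_lzero[OF bilinear_G]
    by (simp add: R_coords flip: bilinear_ladd[OF bilinear_G])
qed (rule R_skew)

lemma bilinear_S: "bilinear S"
  unfolding bilinear_def ricci_def trace_def matrix_def
  by (auto intro!: linearI simp: linear_add[OF R_linear(1)] linear_add[OF R_linear(2)]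
    linear_scale[OF R_linear(1)] linear_scale[OF R_linear(2)] sum.distrib sum_distrib_left)

lemmas S_simps = bilinear_ladd[OF bilinear_S] bilinear_radd[OF bilinear_S]
  bilinear_lsub[OF bilinear_S] bilinear_rsub[OF bilinear_S]
  bilinear_lmul[OF bilinear_S] bilinear_rmul[OF bilinear_S]

text \<open>
  The trace becomes a double sum over the inverse metric of \<open>G (R e\<^sub>i y z) e\<^sub>l\<close>. By pair symmetry,
  exchanging \<open>y\<close> and \<open>z\<close> in such a term amounts to exchanging \<open>i\<close> and \<open>l\<close>, and the inverse metric
  is symmetric.
\<close>

lemma S_sym: "S y z = S z y"
proof -
  let ?H = "matrix_inv (g c p)"
  have inv: "g c p ** ?H = mat 1" "?H ** g c p = mat 1"
    using matrix_inv_right_left metric_nondegenerate[OF c p] by auto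
  have "transpose ?H ** g c p = mat 1"
    using inv(1) by (metis matrix_transpose_mul metric_symmetric[OF c p] transpose_mat)
  then have "transpose ?H = ?H"
    using inv(1) by (metis matrix_mul_assoc matrix_mul_lid matrix_mul_rid)
  then have H_sym: "?H $ i $ l = ?H $ l $ i" for i l
    by (metis (no_types, lifting) transpose_def vec_lambda_beta)
  have comp: "w $ i = (\<Sum>l\<in>UNIV. ?H $ i $ l * G (axis l 1) w)" for w i
  proof -
    have "w $ i = (?H *v (g c p *v w)) $ i" using inv(2) by (simp add: matrix_vector_mul_assoc)
    also have "\<dots> = (\<Sum>l\<in>UNIV. ?H $ i $ l * (g c p *v w) $ l)"
      by (simp only: matrix_vector_mult_def[of ?H] vec_lambda_beta)
    finally show ?thesis by (simp add: metric_at_def inner_axis')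
  qed
  have S_eq: "S y z = (\<Sum>i\<in>UNIV. \<Sum>l\<in>UNIV. ?H $ i $ l * G (axis l 1) (R (axis i 1) y z))" for y z
    by (simp add: ricci_def trace_def matrix_def comp[of "R _ y z"])
  have swap: "G (axis l 1) (R (axis i 1) y z) = G (axis i 1) (R (axis l 1) z y)" for i l
    by (metis G_sym R_antisym R_pair_sym R_skew bilinear_lneg[OF bilinear_G])
  show ?thesis
    unfolding S_eq by (subst sum.swap) (simp add: swap H_sym)
qed

text \<open>
  The description that defines the Ricci operator is satisfied by exactly one vector, since the
  metric is nondegenerate.
\<close>

lemma G_Q: "G (Q x) y = S x y"
proof -
  let ?q = "matrix_inv (g c p) *v (\<chi> l. S x (axis l 1))"
  have "g c p *v ?q = (\<chi> l. S x (axis l 1))"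
    using matrix_inv_right_left(1)[OF metric_nondegenerate[OF c p]] by (simp add: matrix_vector_mul_assoc)
  then have "G y ?q = (\<Sum>l\<in>UNIV. y $ l * S x (axis l 1))" for y
    by (simp add: metric_at_def inner_vec_def)
  moreover have "S x y = (\<Sum>l\<in>UNIV. y $ l * S x (axis l 1))" for y
    using bilinear_S by (intro linear_axis_expansion) (simp add: bilinear_def)
  ultimately have "\<forall>y. G ?q y = S x y" by (metis G_sym)
  moreover have "q = ?q" if "\<forall>y. G q y = S x y" for q
    using that calculation by (intro G_nondegenerate) simp
  ultimately have "\<forall>y. G (Q x) y = S x y"
    unfolding ricci_operator_def by (rule theI)
  then show ?thesis by blast
qed

lemma S_Q: "ricci_sq g c p x y = S x (Q y)"
  unfolding ricci_sq_def by (metis G_Q G_sym S_sym)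

lemma G_T:
  "G (T_tensor a g c p x y z) w =
     a 0 * G (R x y z) w + a 1 * S y z * G x w + a 2 * S x z * G y w + a 3 * S x y * G z w
     + a 4 * G y z * S x w + a 5 * G x z * S y w + a 6 * G x y * S z w
     + a 7 * r * (G y z * G x w - G x z * G y w)"
  by (simp add: T_tensor_def G_simps G_Q)

end

section \<open>Consequences of the nullity condition\<close>

locale Nk_point = Nk_semi_riemannian_manifold M A g k \<epsilon> \<xi> + semi_riemannian_point M A g c p
  for M :: "'a topology" and A :: "('a, 'n::finite) chart set" and g :: "('a, 'n) metric_field"
    and k \<epsilon> :: real and \<xi> :: "('a, 'n) chart \<Rightarrow> 'a \<Rightarrow> real^'n" and c p
begin

abbreviation "\<xi>\<^sub>p \<equiv> \<xi> c p"
abbreviation "e x \<equiv> G x \<xi>\<^sub>p"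
text \<open>
  The eigenvalue of the Ricci operator on \<open>\<xi>\<close>.
\<close>

definition "\<kappa> = k * (real CARD('n) - 1)"

lemma e_xi: "e \<xi>\<^sub>p = \<epsilon>"
  by (rule xi_unit[OF c p])

lemma R_xi: "R x y \<xi>\<^sub>p = k *\<^sub>R (e y *\<^sub>R x - e x *\<^sub>R y)"
  using xi_nullity[OF c p] unfolding in_nullity_distribution_def by blast

lemma G_R_xi: "G (R x y z) \<xi>\<^sub>p = k * (G y z * e x - G x z * e y)"
  by (subst R_skew) (simp add: R_xi G_simps algebra_simps)

text \<open>
  The nullity condition prescribes \<open>R x y \<xi>\<close>; pair symmetry turns it into a formula with \<open>\<xi>\<close> in
  the first slot. It says that \<open>R \<xi> x\<close> is \<open>k\<close> times the metric wedge of \<open>\<xi>\<close> and \<open>x\<close>.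
\<close>

lemma R_xi_left: "R \<xi>\<^sub>p x y = k *\<^sub>R (G x y *\<^sub>R \<xi>\<^sub>p - e y *\<^sub>R x)"
proof (rule G_nondegenerate)
  fix w
  have "G (R \<xi>\<^sub>p x y) w = G (R y w \<xi>\<^sub>p) x" by (rule R_pair_sym)
  also have "\<dots> = G (k *\<^sub>R (G x y *\<^sub>R \<xi>\<^sub>p - e y *\<^sub>R x)) w"
    by (simp add: R_xi G_simps G_sym[of w] G_sym[of y x] algebra_simps)
  finally show "G (R \<xi>\<^sub>p x y) w = G (k *\<^sub>R (G x y *\<^sub>R \<xi>\<^sub>p - e y *\<^sub>R x)) w" .
qed

text \<open>
  The trace of \<open>x \<mapsto> e y *\<^sub>R x - e x *\<^sub>R y\<close> is \<open>(n - 1) * e y\<close>.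
\<close>

lemma S_xi: "S y \<xi>\<^sub>p = \<kappa> * e y" "S \<xi>\<^sub>p y = \<kappa> * e y"
proof -
  have "e y = (\<Sum>i\<in>UNIV. y $ i * e (axis i 1))"
    using bilinear_G by (intro linear_axis_expansion) (simp add: bilinear_def)
  then have "(\<Sum>i\<in>UNIV. e (axis i 1) * y $ i) = e y" by (simp add: mult.commute)
  moreover have "S y \<xi>\<^sub>p = (\<Sum>i\<in>UNIV. k * e y - k * (e (axis i 1) * y $ i))"
    by (simp add: ricci_def trace_def matrix_def R_xi right_diff_distrib)
  ultimately have "S y \<xi>\<^sub>p = k * (real CARD('n) * e y) - k * e y"
    by (simp add: sum_subtractf flip: sum_distrib_left)
  then show "S y \<xi>\<^sub>p = \<kappa> * e y" by (simp add: \<kappa>_def algebra_simps)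
  then show "S \<xi>\<^sub>p y = \<kappa> * e y" by (subst S_sym)
qed

lemma Q_xi: "Q \<xi>\<^sub>p = \<kappa> *\<^sub>R \<xi>\<^sub>p"
proof (rule G_nondegenerate)
  show "G (Q \<xi>\<^sub>p) w = G (\<kappa> *\<^sub>R \<xi>\<^sub>p) w" for w
    by (simp add: G_Q S_xi G_simps G_sym[of \<xi>\<^sub>p w])
qed

section \<open>The action of a wedge on the tensor field\<close>

text \<open>
  Both sides of the pseudosymmetry condition, at the arguments \<open>\<xi>, V, W; \<xi>, X\<close>, are actions of an
  endomorphism \<open>wedge B \<xi> X\<close>: with \<open>B = k * G\<close> and \<open>b = k\<close> on the left by the nullity condition,
  with \<open>B = S\<close> and \<open>b = \<kappa>\<close> on the right. Their \<open>\<xi>\<close>-components are therefore computed once for all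
  \<open>B\<close> that have \<open>b * e\<close> as contraction with \<open>\<xi>\<close>. The endomorphism sends \<open>y\<close> to
  \<open>B X y *\<^sub>R \<xi> - (b * e y) *\<^sub>R X\<close>, so each slot contributes values of the tensor with \<open>\<xi>\<close> or \<open>X\<close>
  inserted. The terms in \<open>G V W\<close> and \<open>S V W\<close> appear twice with each sign and cancel, and so do
  those with three factors \<open>e\<close>.
\<close>

lemma wedge_action:
  fixes B :: "real^'n \<Rightarrow> real^'n \<Rightarrow> real" and b :: real
  assumes B: "bilinear B" "\<And>y. B y \<xi>\<^sub>p = b * e y" "\<And>y. B \<xi>\<^sub>p y = b * e y"
  shows "G (endo_act (wedge B \<xi>\<^sub>p X) (T_tensor a g c p) \<xi>\<^sub>p V W) \<xi>\<^sub>p = \<epsilon> *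
    ((a 5 * B X (Q V) - (k * a 0 + a 7 * r + \<kappa> * (a 1 + a 3 + a 4 + a 5 + a 6)) * B X V
       + b * (a 1 + a 3) * S X V + b * (k * a 0 + a 7 * r + \<kappa> * (a 4 + a 6)) * G X V) * e W
   + (a 6 * B X (Q W) - \<kappa> * (a 1 + a 2 + a 4 + a 5 + a 6) * B X W
       + b * (a 1 + a 2) * S X W + b * \<kappa> * (a 4 + a 5) * G X W) * e V)"
proof -
  let ?T = "T_tensor a g c p"
  have BT: "B X (?T \<xi>\<^sub>p V W) =
      (k * a 0 + a 7 * r) * (G V W * b * e X - e W * B X V) + a 1 * S V W * b * e X
      + a 2 * \<kappa> * e W * B X V + a 3 * \<kappa> * e V * B X W + a 4 * G V W * \<kappa> * b * e X
      + a 5 * e W * B X (Q V) + a 6 * e V * B X (Q W)"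
    by (simp add: T_tensor_def R_xi_left Q_xi S_xi B G_sym[of \<xi>\<^sub>p V] G_sym[of \<xi>\<^sub>p W]
      bilinear_radd[OF B(1)] bilinear_rsub[OF B(1)] bilinear_rmul[OF B(1)] algebra_simps)
  have T\<xi>: "e (?T x y z) =
      (k * a 0 + a 7 * r) * (G y z * e x - G x z * e y)
      + a 1 * S y z * e x + a 2 * S x z * e y + a 3 * S x y * e z
      + \<kappa> * (a 4 * G y z * e x + a 5 * G x z * e y + a 6 * G x y * e z)" for x y z
    by (simp add: G_T G_R_xi S_xi algebra_simps)
  have F: "wedge B \<xi>\<^sub>p X y = B X y *\<^sub>R \<xi>\<^sub>p - (b * e y) *\<^sub>R X" for y
    by (simp add: wedge_def B)
  have "G (endo_act (wedge B \<xi>\<^sub>p X) ?T \<xi>\<^sub>p V W) \<xi>\<^sub>p = \<epsilon> * B X (?T \<xi>\<^sub>p V W) - b * e (?T \<xi>\<^sub>p V W) * e X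
      - e (?T (B X \<xi>\<^sub>p *\<^sub>R \<xi>\<^sub>p - (b * e \<xi>\<^sub>p) *\<^sub>R X) V W)
      - e (?T \<xi>\<^sub>p (B X V *\<^sub>R \<xi>\<^sub>p - (b * e V) *\<^sub>R X) W)
      - e (?T \<xi>\<^sub>p V (B X W *\<^sub>R \<xi>\<^sub>p - (b * e W) *\<^sub>R X))"
    by (simp add: endo_act_def F G_simps e_xi)
  also have "\<dots> = \<epsilon> *
    ((a 5 * B X (Q V) - (k * a 0 + a 7 * r + \<kappa> * (a 1 + a 3 + a 4 + a 5 + a 6)) * B X V
       + b * (a 1 + a 3) * S X V + b * (k * a 0 + a 7 * r + \<kappa> * (a 4 + a 6)) * G X V) * e W
   + (a 6 * B X (Q W) - \<kappa> * (a 1 + a 2 + a 4 + a 5 + a 6) * B X W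
       + b * (a 1 + a 2) * S X W + b * \<kappa> * (a 4 + a 5) * G X W) * e V)"
    unfolding BT T\<xi>
    by (simp add: G_simps S_simps S_xi e_xi B G_sym[of \<xi>\<^sub>p V] G_sym[of \<xi>\<^sub>p W] G_sym[of \<xi>\<^sub>p X] G_sym[of V X] S_sym[of V X] algebra_simps)
  finally show ?thesis .
qed

end

section \<open>The identity\<close>

theorem corollary5p9:
  fixes M :: "'a topology" and A :: "('a, 'n::finite) chart set"
    and g :: "('a, 'n) metric_field" and k \<epsilon> :: real
    and \<xi> X V W :: "('a, 'n) chart \<Rightarrow> 'a \<Rightarrow> real^'n"
    and a :: "nat \<Rightarrow> real" and L :: "'a \<Rightarrow> real"
  assumes "Nk_semi_riemannian_manifold M A g k \<epsilon> \<xi>"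
    and "pseudosymmetric_with A g a L"
    and "vector_field A (U_S A g a) X"
    and "vector_field A (U_S A g a) V"
    and "vector_field A (U_S A g a) W"
    and "p \<in> U_S A g a" and "c \<in> A" and "p \<in> fst c"
  shows
    "let n = real CARD('n);
         G = (\<lambda>Y Z. metric_at g c p (Y c p) (Z c p));
         S = (\<lambda>Y Z. ricci g c p (Y c p) (Z c p));
         S2 = (\<lambda>Y Z. ricci_sq g c p (Y c p) (Z c p));
         \<eta> = (\<lambda>Y. eta g \<epsilon> \<xi> c p (Y c p));
         r = scalar_curvature g c p
     in k * (a 1 + a 3 + a 5) * (S X V - k * (n - 1) * G X V) * \<eta> W
        + k * (a 1 + a 2 + a 6) * (S X W - k * (n - 1) * G X W) * \<eta> V
      = L p *
        (- (k * a 0 + k * (n - 1) * (a 4 + a 5 + a 6) + a 7 * r) * S X V * \<eta> W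
         + k * (n - 1) * (k * a 0 + k * (n - 1) * (a 4 + a 6) + a 7 * r) * G X V * \<eta> W
         + k\<^sup>2 * (n - 1)\<^sup>2 * (a 4 + a 5) * G X W * \<eta> V
         - k * (n - 1) * (a 4 + a 5 + a 6) * S X W * \<eta> V
         + a 5 * S2 X V * \<eta> W
         + a 6 * S2 X W * \<eta> V)"
proof -
  interpret Nk_semi_riemannian_manifold M A g k \<epsilon> \<xi> by fact
  interpret Nk_point M A g k \<epsilon> \<xi> c p by unfold_locales fact+
  let ?X = "X c p" and ?V = "V c p" and ?W = "W c p"
  let ?T = "T_tensor a g c p"
  have "R_dot_T a g c p \<xi>\<^sub>p ?V ?W \<xi>\<^sub>p ?X = L p *\<^sub>R Q_S_T a g c p \<xi>\<^sub>p ?V ?W \<xi>\<^sub>p ?X"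
    using assms unfolding pseudosymmetric_with_def by blast
  moreover have "R \<xi>\<^sub>p ?X = wedge (\<lambda>x y. k * G x y) \<xi>\<^sub>p ?X"
    by (simp add: fun_eq_iff wedge_def R_xi_left G_sym[of \<xi>\<^sub>p] algebra_simps)
  ultimately have "G (endo_act (wedge (\<lambda>x y. k * G x y) \<xi>\<^sub>p ?X) ?T \<xi>\<^sub>p ?V ?W) \<xi>\<^sub>p
      = L p * G (endo_act (wedge S \<xi>\<^sub>p ?X) ?T \<xi>\<^sub>p ?V ?W) \<xi>\<^sub>p"
    unfolding R_dot_T_def Q_S_T_def by (simp add: G_simps)
  moreover have "bilinear (\<lambda>x y. k * G x y)"
    using bilinear_G unfolding bilinear_def
    by (auto intro!: linearI simp: G_simps algebra_simps)
  note kG_action = wedge_action[where B = "\<lambda>x y. k * G x y" and b = k, OF this refl arg_cong[OF G_sym]]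
  note S_action = wedge_action[where B = S and b = \<kappa>, OF bilinear_S S_xi]
  \<comment> \<open>The factor \<open>\<epsilon>\<close> that remains on both sides turns \<open>e\<close> into \<open>\<eta>\<close>.\<close>
  ultimately have "\<epsilon> * (k * (a 1 + a 3 + a 5) * (S ?X ?V - \<kappa> * G ?X ?V) * e ?W
        + k * (a 1 + a 2 + a 6) * (S ?X ?W - \<kappa> * G ?X ?W) * e ?V)
      = \<epsilon> * (L p * (- (k * a 0 + \<kappa> * (a 4 + a 5 + a 6) + a 7 * r) * S ?X ?V * e ?W
         + \<kappa> * (k * a 0 + \<kappa> * (a 4 + a 6) + a 7 * r) * G ?X ?V * e ?W
         + \<kappa>\<^sup>2 * (a 4 + a 5) * G ?X ?W * e ?V
         - \<kappa> * (a 4 + a 5 + a 6) * S ?X ?W * e ?V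
         + a 5 * S ?X (Q ?V) * e ?W
         + a 6 * S ?X (Q ?W) * e ?V))"
    unfolding kG_action S_action
    by (simp add: G_sym[of ?X "Q _"] G_Q S_sym[of _ ?X] power2_eq_square algebra_simps)
  moreover have "k\<^sup>2 * (real CARD('n) - 1)\<^sup>2 = \<kappa>\<^sup>2"
    by (simp only: \<kappa>_def power_mult_distrib)
  ultimately show ?thesis
    unfolding Let_def eta_def S_Q \<kappa>_def[symmetric] by (simp add: algebra_simps)
qed

end
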